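(* Let $\mathcal F$ be an arbitrary set and let $\{\mathbb H_N'\}_{N\ge1}$ be a sequence of mappings from the underlying probability space into $l^\infty(\mathcal F)$ such that each $\mathbb H_N'$ depends on the sample point only through $\mathbf Y_N,\mathbf X_N,\mathbf S_N$ and such that $\mathbb H_N'f$ is measurable for every $N$ and every $f\in\mathcal F$. Let $\mathbb H'$ be a Borel measurable and tight mapping from some probability space into $l^\infty(\mathcal F)$ and assume that $$\sup_{h\in BL_1(l^\infty(\mathcal F))}|E_dh(\mathbb H_N')-Eh(\mathbb H')|\to0\quad\text{in outer probability (outer almost surely)}.$$ Then $\{\mathbb H_N'\}$ satisfies the probability (almost sure) version of conditional asymptotic tightness: for every $\eta>0$ there is a compact set $K\subset l^\infty(\mathcal F)$ such that for every $\delta>0$ there is a sequence of random variables $\widetilde A_N\to0$ in probability (almost surely) with $$P_d\{\mathbb H_N'\in K^\delta\}+\widetilde A_N\ge1-\eta\quad\text{for every }N=1,2,\dots.$$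
   Context: Probability framework. $(\mathcal Y,\mathcal A)$ and $(\mathcal X,\mathcal B)$ are measurable spaces. The underlying probability space is $\prod_{i=1}^\infty(\Omega_{y,x},\mathcal A_{y,x},P_{y,x})\times(\Omega_d,\mathcal A_d,P_d)$ with product measure $P$. The pairs $(Y_i,X_i)$, $i\ge1$, are the coordinate projections on the first infinitely many coordinates; they are i.i.d. with values in $\mathcal Y\times\mathcal X$. Put $\mathbf Y_N=(Y_1,\dots,Y_N)$, $\mathbf X_N=(X_1,\dots,X_N)$. $D$ is a uniform-$[0,1]$ random variable depending only on the last coordinate. A sampling design gives, for each $N$, selection probabilities $\mathfrak p_N(\mathbf s;\mathbf X_N)\ge0$, $\mathbf s\in\{0,1\}^N$, summing to $1$; designs are assumed measurable, i.e. $\mathbf X_N\mapsto\mathfrak p_N(\mathbf s;\mathbf X_N)$ is measurable for each $\mathbf s$. Enumerating $\{0,1\}^N$ as $\mathbf s^{(1)},\dots,\mathbf s^{(2^N)}$, the vector of inclusion indicators $\mathbf S_N$ equals $\mathbf s^{(1)}$ if $D\le\mathfrak p_N(\mathbf s^{(1)};\mathbf X_N)$, and $\mathbf s^{(i)}$ if $\sum_{j<i}\mathfrak p_N(\mathbf s^{(j)};\mathbf X_N)<D\le\sum_{j\le i}\mathfrak p_N(\mathbf s^{(j)};\mathbf X_N)$. For any (not necessarily measurable) function $g$, $E_dg(\mathbf S_N,\mathbf Y_N,\mathbf X_N):=\sum_{\mathbf s}g(\mathbf s,\mathbf Y_N,\mathbf X_N)\mathfrak p_N(\mathbf s;\mathbf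 X_N)$, a (possibly nonmeasurable) function of $(\mathbf Y_N,\mathbf X_N)$; $P_d$ of an event determined by $(\mathbf S_N,\mathbf Y_N,\mathbf X_N)$ is $E_d$ of its indicator. $l^\infty(\mathcal F)$ is the space of bounded real functions on $\mathcal F$ with norm $\|z\|_{\mathcal F}=\sup_{f\in\mathcal F}|z(f)|$. $BL_1(l^\infty(\mathcal F))$ is the set of $h:l^\infty(\mathcal F)\to[0,1]$ with $|h(z_1)-h(z_2)|\le\|z_1-z_2\|_{\mathcal F}$ for all $z_1,z_2$. $K^\delta:=\{z\in l^\infty(\mathcal F):\|z-z'\|_{\mathcal F}<\delta\text{ for some }z'\in K\}$. The outer-probability hypothesis gives the probability version of the conclusion and the outer-almost-sure hypothesis gives the almost sure version. *)

theory Defs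
  imports "HOL-Probability.Probability"
begin

section \<open>The space of bounded functions on an arbitrary set\<close>

text \<open>
  Elements are bounded on \<open>F\<close> and extensional (\<open>undefined\<close> off \<open>F\<close>), so that equal functions on
  \<open>F\<close> are the same point; the metric is \<open>\<lambda>z w. SUP f\<in>F. \<bar>z f - w f\<bar>\<close>.  The set \<open>F\<close> may be empty,
  and then the space is a single point.
\<close>

definition linf :: "'f set \<Rightarrow> ('f \<Rightarrow> real) metric" where
  "linf F = funspace F euclidean_metric"

definition linf_borel :: "'f set \<Rightarrow> ('f \<Rightarrow> real) measure" where
  "linf_borel F = sigma (mspace (linf F)) {U. openin (mtopology_of (linf F)) U}"

text \<open>
  HOL functions are total, so a member of \<open>BL1 F\<close> is constrained on \<open>mspace (linf F)\<close> only.
\<close>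

definition BL1 :: "'f set \<Rightarrow> (('f \<Rightarrow> real) \<Rightarrow> real) set" where
  "BL1 F = {h. (\<forall>z\<in>mspace (linf F). 0 \<le> h z \<and> h z \<le> 1) \<and>
               (\<forall>z\<in>mspace (linf F). \<forall>w\<in>mspace (linf F). \<bar>h z - h w\<bar> \<le> mdist (linf F) z w)}"

definition enlargement :: "'f set \<Rightarrow> ('f \<Rightarrow> real) set \<Rightarrow> real \<Rightarrow> ('f \<Rightarrow> real) set" where
  "enlargement F K \<delta> = {z \<in> mspace (linf F). \<exists>w\<in>K. mdist (linf F) z w < \<delta>}"

definition tight_map :: "'f set \<Rightarrow> 'b measure \<Rightarrow> ('b \<Rightarrow> 'f \<Rightarrow> real) \<Rightarrow> bool" where
  "tight_map F M H \<longleftrightarrow>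
     (\<forall>\<epsilon>>0. \<exists>K. compactin (mtopology_of (linf F)) K \<and>
        measure M {\<omega>\<in>space M. H \<omega> \<in> K} \<ge> 1 - \<epsilon>)"


section \<open>Modes of convergence to zero\<close>

text \<open>Sequences are indexed by \<open>N \<ge> 1\<close>; the value at \<open>0\<close> plays no role.\<close>

definition conv_in_prob :: "'a measure \<Rightarrow> (nat \<Rightarrow> 'a \<Rightarrow> real) \<Rightarrow> bool" where
  "conv_in_prob M A \<longleftrightarrow>
     (\<forall>\<epsilon>>0. (\<lambda>N. measure M {\<omega>\<in>space M. \<bar>A N \<omega>\<bar> > \<epsilon>}) \<longlonglongrightarrow> 0)"

definition conv_almost_surely :: "'a measure \<Rightarrow> (nat \<Rightarrow> 'a \<Rightarrow> real) \<Rightarrow> bool" where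
  "conv_almost_surely M A \<longleftrightarrow> (AE \<omega> in M. (\<lambda>N. A N \<omega>) \<longlonglongrightarrow> 0)"

definition conv_outer_prob :: "'a measure \<Rightarrow> (nat \<Rightarrow> 'a \<Rightarrow> real) \<Rightarrow> bool" where
  "conv_outer_prob M T \<longleftrightarrow>
     (\<forall>\<epsilon>>0. (\<lambda>N. outer_measure_of M {\<omega>\<in>space M. \<bar>T N \<omega>\<bar> > \<epsilon>}) \<longlonglongrightarrow> 0)"

text \<open>
  \<open>U\<close> is a version of the minimal measurable majorant of the arbitrary function \<open>T\<close>; outer almost
  sure convergence is almost sure convergence of such majorants (van der Vaart and Wellner,
  \<^emph>\<open>Weak Convergence and Empirical Processes\<close>, Sections 1.2 and 1.9).
\<close>

definition measurable_cover :: "'a measure \<Rightarrow> ('a \<Rightarrow> real) \<Rightarrow> ('a \<Rightarrow> ereal) \<Rightarrow> bool" where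
  "measurable_cover M T U \<longleftrightarrow>
     U \<in> borel_measurable M \<and>
     (\<forall>\<omega>\<in>space M. ereal (T \<omega>) \<le> U \<omega>) \<and>
     (\<forall>V\<in>borel_measurable M. (AE \<omega> in M. ereal (T \<omega>) \<le> V \<omega>) \<longrightarrow> (AE \<omega> in M. U \<omega> \<le> V \<omega>))"

definition conv_outer_almost_surely :: "'a measure \<Rightarrow> (nat \<Rightarrow> 'a \<Rightarrow> real) \<Rightarrow> bool" where
  "conv_outer_almost_surely M T \<longleftrightarrow>
     (\<exists>U. (\<forall>N\<ge>1. measurable_cover M (\<lambda>\<omega>. \<bar>T N \<omega>\<bar>) (U N)) \<and>
          (AE \<omega> in M. (\<lambda>N. U N \<omega>) \<longlonglongrightarrow> 0))"


section \<open>Sampling designs\<close>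

text \<open>
  \<open>R\<close> is the common law of the pairs \<open>(Y\<^sub>i, X\<^sub>i)\<close>, which are the coordinate projections of the
  first factor; the second factor carries the randomisation of the design.
\<close>

definition sample_space ::
  "('y \<times> 'x) measure \<Rightarrow> 'd measure \<Rightarrow> ((nat \<Rightarrow> 'y \<times> 'x) \<times> 'd) measure" where
  "sample_space R Pd = (\<Pi>\<^sub>M i\<in>{1..}. R) \<Otimes>\<^sub>M Pd"

definition Yvec :: "nat \<Rightarrow> (nat \<Rightarrow> 'y \<times> 'x) \<times> 'd \<Rightarrow> nat \<Rightarrow> 'y" where
  "Yvec N \<omega> = (\<lambda>i\<in>{1..N}. fst (fst \<omega> i))"

definition Xvec :: "nat \<Rightarrow> (nat \<Rightarrow> 'y \<times> 'x) \<times> 'd \<Rightarrow> nat \<Rightarrow> 'x" where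
  "Xvec N \<omega> = (\<lambda>i\<in>{1..N}. snd (fst \<omega> i))"

definition cube :: "nat \<Rightarrow> (nat \<Rightarrow> nat) set" where
  "cube N = {1..N} \<rightarrow>\<^sub>E {0, 1}"

definition sampling_design ::
  "'x measure \<Rightarrow> (nat \<Rightarrow> (nat \<Rightarrow> nat) \<Rightarrow> (nat \<Rightarrow> 'x) \<Rightarrow> real) \<Rightarrow> bool" where
  "sampling_design B p \<longleftrightarrow>
     (\<forall>N\<ge>1.
        (\<forall>s\<in>cube N. p N s \<in> borel_measurable (\<Pi>\<^sub>M i\<in>{1..N}. B)) \<and>
        (\<forall>x\<in>space (\<Pi>\<^sub>M i\<in>{1..N}. B).
           (\<forall>s\<in>cube N. 0 \<le> p N s x) \<and> (\<Sum>s\<in>cube N. p N s x) = 1))"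

text \<open>
  \<open>e N 1, \<dots>, e N (2 ^ N)\<close> enumerates \<open>cube N\<close>.  The index in the second case exists and is unique
  whenever \<open>D\<close> takes a value in \<open>[0,1]\<close> exceeding the first selection probability.
\<close>

definition Svec ::
  "(nat \<Rightarrow> nat \<Rightarrow> nat \<Rightarrow> nat) \<Rightarrow> (nat \<Rightarrow> (nat \<Rightarrow> nat) \<Rightarrow> (nat \<Rightarrow> 'x) \<Rightarrow> real) \<Rightarrow> ('d \<Rightarrow> real) \<Rightarrow>
   nat \<Rightarrow> (nat \<Rightarrow> 'y \<times> 'x) \<times> 'd \<Rightarrow> nat \<Rightarrow> nat" where
  "Svec e p D N \<omega> =
     (let x = Xvec N \<omega>; d = D (snd \<omega>) in
      if d \<le> p N (e N 1) x then e N 1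
      else e N (THE i. i \<in> {2..2 ^ N} \<and>
                  (\<Sum>j\<in>{1..<i}. p N (e N j) x) < d \<and> d \<le> (\<Sum>j\<in>{1..i}. p N (e N j) x)))"

definition design_expectation ::
  "(nat \<Rightarrow> (nat \<Rightarrow> nat) \<Rightarrow> (nat \<Rightarrow> 'x) \<Rightarrow> real) \<Rightarrow> nat \<Rightarrow>
   ((nat \<Rightarrow> nat) \<Rightarrow> (nat \<Rightarrow> 'y) \<Rightarrow> (nat \<Rightarrow> 'x) \<Rightarrow> real) \<Rightarrow> (nat \<Rightarrow> 'y) \<Rightarrow> (nat \<Rightarrow> 'x) \<Rightarrow> real" where
  "design_expectation p N g y x = (\<Sum>s\<in>cube N. g s y x * p N s x)"

definition design_prob ::
  "(nat \<Rightarrow> (nat \<Rightarrow> nat) \<Rightarrow> (nat \<Rightarrow> 'x) \<Rightarrow> real) \<Rightarrow> nat \<Rightarrow>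
   ((nat \<Rightarrow> nat) \<Rightarrow> (nat \<Rightarrow> 'y) \<Rightarrow> (nat \<Rightarrow> 'x) \<Rightarrow> bool) \<Rightarrow> (nat \<Rightarrow> 'y) \<Rightarrow> (nat \<Rightarrow> 'x) \<Rightarrow> real" where
  "design_prob p N Q = design_expectation p N (\<lambda>s y x. of_bool (Q s y x))"


section \<open>Conditional weak convergence and conditional asymptotic tightness\<close>

text \<open>
  A sequence of maps \<open>H\<close> on the sample space that depends on the sample point only through
  \<open>Svec\<close>, \<open>Yvec\<close>, \<open>Xvec\<close> is represented by \<open>G\<close> with
  \<open>H N \<omega> = G N (Svec e p D N \<omega>) (Yvec N \<omega>) (Xvec N \<omega>)\<close>.  The choice of \<open>G\<close> is immaterial below: samples
  \<open>s\<close> that are never selected at \<open>(y, x)\<close> have \<open>p N s x = 0\<close>.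
\<close>

definition BL1_discrepancy ::
  "'f set \<Rightarrow> (nat \<Rightarrow> (nat \<Rightarrow> nat) \<Rightarrow> (nat \<Rightarrow> 'x) \<Rightarrow> real) \<Rightarrow>
   (nat \<Rightarrow> (nat \<Rightarrow> nat) \<Rightarrow> (nat \<Rightarrow> 'y) \<Rightarrow> (nat \<Rightarrow> 'x) \<Rightarrow> 'f \<Rightarrow> real) \<Rightarrow>
   'b measure \<Rightarrow> ('b \<Rightarrow> 'f \<Rightarrow> real) \<Rightarrow> nat \<Rightarrow> (nat \<Rightarrow> 'y \<times> 'x) \<times> 'd \<Rightarrow> real" where
  "BL1_discrepancy F p G M Hlim N \<omega> =
     (SUP h\<in>BL1 F. \<bar>design_expectation p N (\<lambda>s y x. h (G N s y x)) (Yvec N \<omega>) (Xvec N \<omega>)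
                     - (\<integral>w. h (Hlim w) \<partial>M)\<bar>)"

text \<open>
  The mode of convergence \<open>conv\<close> is \<^const>\<open>conv_in_prob\<close> or \<^const>\<open>conv_almost_surely\<close>; \<open>P\<close> is the
  sample space.
\<close>

definition cond_asymp_tight ::
  "(((nat \<Rightarrow> 'y \<times> 'x) \<times> 'd) measure \<Rightarrow> (nat \<Rightarrow> (nat \<Rightarrow> 'y \<times> 'x) \<times> 'd \<Rightarrow> real) \<Rightarrow> bool) \<Rightarrow>
   ((nat \<Rightarrow> 'y \<times> 'x) \<times> 'd) measure \<Rightarrow> 'f set \<Rightarrow>
   (nat \<Rightarrow> (nat \<Rightarrow> nat) \<Rightarrow> (nat \<Rightarrow> 'x) \<Rightarrow> real) \<Rightarrow>
   (nat \<Rightarrow> (nat \<Rightarrow> nat) \<Rightarrow> (nat \<Rightarrow> 'y) \<Rightarrow> (nat \<Rightarrow> 'x) \<Rightarrow> 'f \<Rightarrow> real) \<Rightarrow> bool" where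
  "cond_asymp_tight conv P F p G \<longleftrightarrow>
     (\<forall>\<eta>>0. \<exists>K. compactin (mtopology_of (linf F)) K \<and>
        (\<forall>\<delta>>0. \<exists>A. (\<forall>N\<ge>1. A N \<in> borel_measurable P) \<and> conv P A \<and>
           (\<forall>N\<ge>1. \<forall>\<omega>\<in>space P.
              design_prob p N (\<lambda>s y x. G N s y x \<in> enlargement F K \<delta>) (Yvec N \<omega>) (Xvec N \<omega>)
                + A N \<omega> \<ge> 1 - \<eta>)))"

end

theory Submission
  imports Defs
begin

text \<open>
  Given a compact \<open>K\<close> carrying all but \<open>\<eta>\<close> of the limit law, the tent function
  \<open>h z = SUP w\<in>K. max 0 (c - d z w)\<close> with \<open>c = min \<delta> 1\<close> is a bounded Lipschitz function which equals
  \<open>c\<close> on \<open>K\<close> and vanishes off \<open>K\<^sup>\<delta>\<close>.  Hence \<open>c P\<^sub>d(H\<^sub>N \<in> K\<^sup>\<delta>) \<ge> E\<^sub>d h(H\<^sub>N) \<ge> E h(H) - T\<^sub>N \<ge> c (1 - \<eta>) - T\<^sub>N\<close>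
  where \<open>T\<^sub>N\<close> is the bounded Lipschitz discrepancy, so a measurable majorant of \<open>min T\<^sub>N 1 / c\<close>
  serves as the remainder.  The discrepancy also involves the values of \<open>G\<close> at samples that no
  sample point realises; these have selection probability zero, because the randomiser falls into
  every subinterval of \<open>[0,1]\<close> of positive length.
\<close>

section \<open>Tent functions around a set in a metric space\<close>

definition tent :: "'a metric \<Rightarrow> 'a set \<Rightarrow> real \<Rightarrow> 'a \<Rightarrow> real" where
  "tent m K c z = (SUP w\<in>K. max 0 (c - mdist m z w))"

lemma tent_upper:
  assumes "0 \<le> c" "w \<in> K"
  shows "max 0 (c - mdist m z w) \<le> tent m K c z"
  unfolding tent_def
proof (rule cSUP_upper[OF assms(2)])
  show "bdd_above ((\<lambda>w. max 0 (c - mdist m z w)) ` K)"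
    by (rule bdd_aboveI2[where M = c]) (use assms in auto)
qed

lemma tent_bounds:
  assumes "0 \<le> c" "K \<noteq> {}"
  shows "0 \<le> tent m K c z" "tent m K c z \<le> c"
proof -
  obtain w where "w \<in> K" using assms by auto
  from tent_upper[OF assms(1) this, of m z] show "0 \<le> tent m K c z" by simp
  show "tent m K c z \<le> c"
    unfolding tent_def by (rule cSUP_least) (use assms in auto)
qed

lemma tent_on:
  assumes "0 \<le> c" "K \<subseteq> mspace m" "z \<in> K"
  shows "tent m K c z = c"
proof -
  have "z \<in> mspace m" using assms by blast
  then have "mdist m z z = 0" by simp
  then have "c \<le> tent m K c z"
    using tent_upper[OF assms(1,3), of m z] by simp
  then show ?thesis using tent_bounds(2)[of c K m z] assms by fastforce
qed

lemma tent_off: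
  assumes "K \<noteq> {}" "\<And>w. w \<in> K \<Longrightarrow> c \<le> mdist m z w"
  shows "tent m K c z = 0"
proof -
  have "tent m K c z = (SUP w\<in>K. 0)"
    unfolding tent_def by (rule SUP_cong) (use assms in auto)
  then show ?thesis using assms by simp
qed

text \<open>By the triangle inequality each term of the supremum moves by at most
  \<open>mdist m z z'\<close>, and this bound passes to the supremum. It is one-sided; exchanging
  the two points gives the Lipschitz condition.\<close>

lemma tent_le_add_mdist:
  assumes "0 \<le> c" "K \<noteq> {}" "K \<subseteq> mspace m" "z \<in> mspace m" "z' \<in> mspace m"
  shows "tent m K c z \<le> tent m K c z' + mdist m z z'"
  unfolding tent_def[of m K c z]
proof (rule cSUP_least)
  fix w assume w: "w \<in> K"
  have "mdist m z' w \<le> mdist m z' z + mdist m z w"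
    by (rule mdist_triangle) (use assms w in auto)
  moreover have "mdist m z' z = mdist m z z'" "0 \<le> mdist m z z'"
    by (auto simp: mdist_commute)
  ultimately show "max 0 (c - mdist m z w) \<le> tent m K c z' + mdist m z z'"
    using tent_upper[OF assms(1) w, of m z'] by linarith
qed (use assms in auto)

text \<open>The tent has slope one whatever its height \<open>c\<close>, so the Lipschitz constant
  is already right; \<open>c \<le> 1\<close> keeps the values in the unit interval.\<close>

lemma tent_in_BL1:
  assumes "0 \<le> c" "c \<le> 1" "K \<noteq> {}" "K \<subseteq> mspace (linf F)"
  shows "tent (linf F) K c \<in> BL1 F"
  unfolding BL1_def
proof (intro CollectI conjI ballI)
  fix z w assume zw: "z \<in> mspace (linf F)" "w \<in> mspace (linf F)"
  show "\<bar>tent (linf F) K c z - tent (linf F) K c w\<bar> \<le> mdist (linf F) z w"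
    using tent_le_add_mdist[OF assms(1,3,4) zw] tent_le_add_mdist[OF assms(1,3,4) zw(2,1)]
    by (simp add: mdist_commute abs_le_iff)
qed (use tent_bounds[OF assms(1,3)] assms(2) order_trans in blast)+

section \<open>Borel sets and bounded Lipschitz functions on the space of bounded functions\<close>

lemma space_linf_borel: "space (linf_borel F) = mspace (linf F)"
  unfolding linf_borel_def
  by (rule space_measure_of) (use openin_subset in fastforce)

lemma openin_in_linf_borel:
  assumes "openin (mtopology_of (linf F)) U"
  shows "U \<in> sets (linf_borel F)"
proof -
  have "{U. openin (mtopology_of (linf F)) U} \<subseteq> Pow (mspace (linf F))"
    using openin_subset by fastforce
  then show ?thesis
    unfolding linf_borel_def using assms by (auto simp: sets_measure_of)
qed

text \<open>A metric topology is Hausdorff, so compact sets are closed. This makes the limit lying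
  in a compact set a measurable event.\<close>

lemma compactin_in_linf_borel:
  assumes "compactin (mtopology_of (linf F)) K"
  shows "K \<in> sets (linf_borel F)"
proof -
  have "Hausdorff_space (mtopology_of (linf F))"
    by (simp add: Metric_space.Hausdorff_space_mtopology mtopology_of_def)
  then have cl: "closedin (mtopology_of (linf F)) K"
    using assms by (rule compactin_imp_closedin)
  then have "mspace (linf F) - K \<in> sets (linf_borel F)"
    by (intro openin_in_linf_borel) (auto simp: closedin_def)
  then have "mspace (linf F) - (mspace (linf F) - K) \<in> sets (linf_borel F)"
    by (metis sets.compl_sets space_linf_borel)
  moreover have "K \<subseteq> mspace (linf F)"
    using closedin_subset[OF cl] by simp
  ultimately show ?thesis
    by (simp add: double_diff)
qed

lemma BL1_measurable:
  assumes "h \<in> BL1 F"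
  shows "h \<in> borel_measurable (linf_borel F)"
proof (rule borel_measurableI)
  fix S :: "real set" assume "open S"
  have "Lipschitz_continuous_map (linf F) euclidean_metric h"
    unfolding Lipschitz_continuous_map_def
    by (intro conjI exI[of _ 1]) (use assms in \<open>auto simp: BL1_def dist_real_def\<close>)
  then have "continuous_map (mtopology_of (linf F)) euclidean h"
    using Lipschitz_continuous_imp_continuous_map by fastforce
  then have "openin (mtopology_of (linf F)) {z \<in> mspace (linf F). h z \<in> S}"
    using openin_continuous_map_preimage[of "mtopology_of (linf F)" euclidean h S] \<open>open S\<close> by simp
  then have "{z \<in> mspace (linf F). h z \<in> S} \<in> sets (linf_borel F)"
    by (rule openin_in_linf_borel)
  moreover have "h -` S \<inter> space (linf_borel F) = {z \<in> mspace (linf F). h z \<in> S}"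
    by (auto simp: space_linf_borel)
  ultimately show "h -` S \<inter> space (linf_borel F) \<in> sets (linf_borel F)"
    by simp
qed

lemma BL1_integral:
  assumes "prob_space M" "Hlim \<in> M \<rightarrow>\<^sub>M linf_borel F" "h \<in> BL1 F"
  shows "integrable M (\<lambda>w. h (Hlim w))"
    and "0 \<le> (\<integral>w. h (Hlim w) \<partial>M)" "(\<integral>w. h (Hlim w) \<partial>M) \<le> 1"
proof -
  interpret M: prob_space M by fact
  \<comment> \<open>Members of \<open>BL1 F\<close> are constrained on the carrier only;
    measurability of \<open>Hlim\<close> places its values there.\<close>
  have b: "0 \<le> h (Hlim w)" "h (Hlim w) \<le> 1" if "w \<in> space M" for w
    using measurable_space[OF assms(2) that] assms(3) by (auto simp: space_linf_borel BL1_def)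
  show i: "integrable M (\<lambda>w. h (Hlim w))"
    by (rule M.integrable_const_bound[of _ 1])
      (use b measurable_compose[OF assms(2) BL1_measurable[OF assms(3)]] in auto)
  show "0 \<le> (\<integral>w. h (Hlim w) \<partial>M)"
    by (rule Bochner_Integration.integral_nonneg) (use b in auto)
  show "(\<integral>w. h (Hlim w) \<partial>M) \<le> 1"
    by (rule M.integral_le_const[OF i]) (use b in auto)
qed

section \<open>The inequality at a fixed sample point\<close>

text \<open>Samples of selection probability zero contribute nothing to either sum, so the
  comparison may be restricted to the others. This matters because \<open>G\<close> is arbitrary at
  samples that are never drawn.\<close>

lemma design_expectation_mono:
  assumes "\<And>s. s \<in> cube N \<Longrightarrow> 0 \<le> p N s x"
    and "\<And>s. s \<in> cube N \<Longrightarrow> 0 < p N s x \<Longrightarrow> g s y x \<le> g' s y x"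
  shows "design_expectation p N g y x \<le> design_expectation p N g' y x"
  unfolding design_expectation_def
proof (rule sum_mono)
  fix s assume "s \<in> cube N"
  with assms show "g s y x * p N s x \<le> g' s y x * p N s x"
    by (cases "p N s x = 0") (auto intro!: mult_right_mono simp: less_le)
qed

lemma design_expectation_const:
  assumes "(\<Sum>s\<in>cube N. p N s x) = 1"
  shows "design_expectation p N (\<lambda>s y x. c) y x = c"
  unfolding design_expectation_def using assms by (simp flip: sum_distrib_left)

lemma design_expectation_cmult:
  "design_expectation p N (\<lambda>s y x. c * g s y x) y x = c * design_expectation p N g y x"
  unfolding design_expectation_def by (simp add: sum_distrib_left mult.assoc)

lemma enlargement_prob_bound:
  assumes p0: "\<And>s. s \<in> cube N \<Longrightarrow> 0 \<le> p N s x" and p1: "(\<Sum>s\<in>cube N. p N s x) = 1"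
    and G: "\<And>s. s \<in> cube N \<Longrightarrow> 0 < p N s x \<Longrightarrow> G N s y x \<in> mspace (linf F)"
    and M: "prob_space M" and Hlim: "Hlim \<in> M \<rightarrow>\<^sub>M linf_borel F"
    and K: "compactin (mtopology_of (linf F)) K" "K \<noteq> {}"
    and \<eta>: "1 - \<eta> \<le> measure M {w\<in>space M. Hlim w \<in> K}"
    and c: "0 < c" "c \<le> 1" "c \<le> \<delta>"
  shows "c * (1 - \<eta> - design_prob p N (\<lambda>s y x. G N s y x \<in> enlargement F K \<delta>) y x)
         \<le> (SUP h\<in>BL1 F. \<bar>design_expectation p N (\<lambda>s y x. h (G N s y x)) y x
                          - (\<integral>w. h (Hlim w) \<partial>M)\<bar>)"
    (is "_ \<le> (SUP h\<in>BL1 F. ?T h)")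
proof -
  interpret M: prob_space M by fact
  have KF: "K \<subseteq> mspace (linf F)"
    using compactin_subset_topspace[OF K(1)] by simp
  define h where "h = tent (linf F) K c"
  have h: "h \<in> BL1 F"
    unfolding h_def by (rule tent_in_BL1) (use c K KF in auto)
  \<comment> \<open>Both expectations lie in the unit interval. The resulting bound makes the family
    bounded above, so that its real supremum dominates each member.\<close>
  have "?T g \<le> 1" if g: "g \<in> BL1 F" for g
  proof -
    have "design_expectation p N (\<lambda>s y x. 0) y x \<le> design_expectation p N (\<lambda>s y x. g (G N s y x)) y x"
      by (rule design_expectation_mono) (use p0 G g in \<open>auto simp: BL1_def\<close>)
    moreover have "design_expectation p N (\<lambda>s y x. g (G N s y x)) y x
        \<le> design_expectation p N (\<lambda>s y x. 1) y x"
      by (rule design_expectation_mono) (use p0 G g in \<open>auto simp: BL1_def\<close>)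
    ultimately show ?thesis
      using BL1_integral(2,3)[OF M Hlim g] unfolding design_expectation_const[of p N x, OF p1] by linarith
  qed
  then have T: "?T h \<le> (SUP h\<in>BL1 F. ?T h)"
    by (intro cSUP_upper[OF h] bdd_aboveI2[where M = 1])
  have "design_expectation p N (\<lambda>s y x. h (G N s y x)) y x
      \<le> design_expectation p N (\<lambda>s y x. c * of_bool (G N s y x \<in> enlargement F K \<delta>)) y x"
  proof (rule design_expectation_mono)
    fix s assume s: "s \<in> cube N" "0 < p N s x"
    show "h (G N s y x) \<le> c * of_bool (G N s y x \<in> enlargement F K \<delta>)"
    proof (cases "G N s y x \<in> enlargement F K \<delta>")
      case True
      then show ?thesis using tent_bounds(2)[of c K] c K by (simp add: h_def)
    next
      case False
      \<comment> \<open>The enlargement is defined by a strict inequality, so off it all distances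
        to \<open>K\<close> are at least \<open>\<delta>\<close>, hence at least
        \<open>c\<close>.\<close>
      then have "c \<le> mdist (linf F) (G N s y x) w" if "w \<in> K" for w
        using G[OF s] that c(3) by (force simp: enlargement_def)
      then show ?thesis using tent_off[of K c "linf F"] K c(1) by (simp add: h_def)
    qed
  qed (use p0 in auto)
  then have le: "design_expectation p N (\<lambda>s y x. h (G N s y x)) y x
      \<le> c * design_prob p N (\<lambda>s y x. G N s y x \<in> enlargement F K \<delta>) y x"
    by (simp add: design_expectation_cmult design_prob_def)
  have KM: "{w\<in>space M. Hlim w \<in> K} \<in> sets M"
    using measurable_sets[OF Hlim compactin_in_linf_borel[OF K(1)]]
    by (simp add: vimage_def Int_def conj_commute)
  have "c * measure M {w\<in>space M. Hlim w \<in> K}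
      = (\<integral>w. c * indicator {w\<in>space M. Hlim w \<in> K} w \<partial>M)"
    using KM by simp
  also have "\<dots> \<le> (\<integral>w. h (Hlim w) \<partial>M)"
  proof (rule integral_mono)
    show "integrable M (\<lambda>w. c * indicator {w\<in>space M. Hlim w \<in> K} w)"
      using KM by (intro integrable_mult_right integrable_real_indicator) (auto simp: M.emeasure_eq_measure)
    show "integrable M (\<lambda>w. h (Hlim w))"
      by (rule BL1_integral[OF M Hlim h])
    fix w
    show "c * indicator {w\<in>space M. Hlim w \<in> K} w \<le> h (Hlim w)"
      using tent_on[of c K "linf F" "Hlim w"] tent_bounds(1)[of c K "linf F" "Hlim w"] c K KF
      by (auto simp: h_def indicator_def)
  qed
  finally have "c * measure M {w\<in>space M. Hlim w \<in> K} \<le> (\<integral>w. h (Hlim w) \<partial>M)" .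
  moreover have "c * (1 - \<eta>) \<le> c * measure M {w\<in>space M. Hlim w \<in> K}"
    using \<eta> c by simp
  ultimately show ?thesis
    using T le by (simp add: right_diff_distrib)
qed

section \<open>Realising every sample of positive selection probability\<close>

text \<open>The interval has mass \<open>b - a > 0\<close> under the law of \<open>D\<close>, and an
  event of positive probability is nonempty; this yields an actual point of the randomisation
  space.\<close>

lemma uniform_hits_interval:
  assumes D: "D \<in> borel_measurable Pd" "distr Pd borel D = uniform_measure lborel {0..1::real}"
    and ab: "0 \<le> a" "a < b" "b \<le> 1"
  shows "\<exists>w\<in>space Pd. a < D w \<and> D w \<le> b"
proof -
  have "emeasure Pd (D -` {a<..b} \<inter> space Pd) = emeasure (distr Pd borel D) {a<..b}"
    using D(1) by (simp add: emeasure_distr)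
  also have "\<dots> = emeasure lborel ({0..1} \<inter> {a<..b}) / emeasure lborel {0..1::real}"
    unfolding D(2) by (rule emeasure_uniform_measure) auto
  also have "{0..1} \<inter> {a<..b} = {a<..b}"
    using ab by auto
  also have "emeasure lborel {a<..b} / emeasure lborel {0..1::real} = ennreal (b - a)"
    using ab by (simp add: divide_ennreal flip: ennreal_1)
  finally have "D -` {a<..b} \<inter> space Pd \<noteq> {}"
    using ab by (metis diff_gt_0_iff_gt emeasure_empty ennreal_eq_0_iff not_le)
  then show ?thesis by auto
qed

text \<open>The cumulative selection probabilities cut the unit interval into cells, and the cell of
  \<open>s\<close> has length \<open>p N s x > 0\<close>, so some value of the randomiser falls into
  it. Only the second coordinate of the sample point changes, which leaves the data as they
  were.\<close>

lemma Svec_realised: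
  assumes D: "D \<in> borel_measurable Pd" "distr Pd borel D = uniform_measure lborel {0..1::real}"
    and e: "bij_betw (e N) {1..2 ^ N} (cube N)"
    and x: "x = Xvec N \<omega>"
    and p0: "\<And>s. s \<in> cube N \<Longrightarrow> 0 \<le> p N s x" and p1: "(\<Sum>s\<in>cube N. p N s x) = 1"
    and s: "s \<in> cube N" "0 < p N s x"
  shows "\<exists>w\<in>space Pd. Svec e p D N (fst \<omega>, w) = s"
proof -
  define q where "q j = p N (e N j) x" for j
  obtain i where i: "i \<in> {1..2 ^ N}" "s = e N i"
    using e s(1) unfolding bij_betw_def by blast
  have q0: "0 \<le> q j" if "j \<in> {1..2 ^ N}" for j
    unfolding q_def using p0 bij_betwE[OF e] that by auto
  have q1: "sum q {1..2 ^ N} = 1"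
    unfolding q_def using p1 sum.reindex_bij_betw[OF e, of "\<lambda>s. p N s x"] by simp
  \<comment> \<open>Cells are disjoint: the right end of an earlier cell does not exceed the left
    end of a later one.\<close>
  have mono: "sum q {1..k} \<le> sum q {1..<l}" if "k < l" "l \<le> 2 ^ N" for k l
    by (rule sum_mono2) (use that q0 in auto)
  have "{1..i} = insert i {1..<i}" using i by auto
  then have step: "sum q {1..i} = q i + sum q {1..<i}" by simp
  have "0 \<le> sum q {1..<i}"
    by (rule sum_nonneg) (use q0 i in auto)
  moreover have "sum q {1..<i} < sum q {1..i}"
    using step s(2) i by (simp add: q_def)
  moreover have "sum q {1..i} \<le> 1"
    unfolding q1[symmetric] by (rule sum_mono2) (use q0 i in auto)
  ultimately obtain w where w: "w \<in> space Pd" "sum q {1..<i} < D w" "D w \<le> sum q {1..i}"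
    using uniform_hits_interval[OF D] by blast
  have X: "Xvec N (fst \<omega>, w) = x" by (simp add: x Xvec_def)
  have "Svec e p D N (fst \<omega>, w) = e N i"
  proof (cases "i = 1")
    case True
    then show ?thesis using w X by (simp add: Svec_def Let_def q_def)
  next
    case False
    \<comment> \<open>For \<open>i \<ge> 2\<close> the first cell ends at or before the left end of
      cell \<open>i\<close>, so the first branch of \<open>Svec\<close> is not taken.\<close>
    have "q 1 \<le> sum q {1..<i}"
      by (rule member_le_sum) (use q0 i False in auto)
    then have ne: "\<not> D w \<le> p N (e N 1) x" using w by (simp add: q_def)
    \<comment> \<open>Disjointness of the cells gives the uniqueness that the definite description
      requires.\<close>
    have "(THE i. i \<in> {2..2 ^ N} \<and> sum q {1..<i} < D w \<and> D w \<le> sum q {1..i}) = i"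
    proof (rule the_equality)
      show "i \<in> {2..2 ^ N} \<and> sum q {1..<i} < D w \<and> D w \<le> sum q {1..i}"
        using w i False by auto
    next
      fix k assume k: "k \<in> {2..2 ^ N} \<and> sum q {1..<k} < D w \<and> D w \<le> sum q {1..k}"
      have False if "k < i"
        using mono[of k i] that k w i by auto
      moreover have False if "i < k"
        using mono[of i k] that k w i by auto
      ultimately show "k = i" by (meson linorder_neqE_nat)
    qed
    then show ?thesis using ne X by (simp add: Svec_def Let_def q_def)
  qed
  then show ?thesis using w(1) i by blast
qed

section \<open>Measurable majorants of the truncated discrepancy\<close>

text \<open>Convergence in outer probability speaks of one threshold at a time. Measurable hulls of
  the exceedance sets at countably many thresholds \<open>r k\<close> decreasing to 0 are combined
  by an infimum into one function that serves every threshold. Inside a hull \<open>T\<close> has no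
  bound of its own, whence the truncation at 1.\<close>

lemma conv_outer_prob_majorant:
  assumes "prob_space P" "conv_outer_prob P T"
  shows "\<exists>V. (\<forall>N. V N \<in> borel_measurable P) \<and> conv_in_prob P V \<and>
             (\<forall>N. \<forall>\<omega>\<in>space P. min (T N \<omega>) 1 \<le> V N \<omega>)"
proof -
  interpret P: prob_space P by fact
  define r :: "nat \<Rightarrow> real" where "r k = 1 / (k + 1)" for k
  have r0: "0 < r k" for k by (simp add: r_def)
  define S where "S N k = {\<omega>\<in>space P. \<bar>T N \<omega>\<bar> > r k}" for N k
  have "\<exists>E\<in>sets P. S N k \<subseteq> E \<and> outer_measure_of P (S N k) = emeasure P E" for N k
    by (rule outer_measure_of_attain) (auto simp: S_def)
  then obtain E where E: "E N k \<in> sets P" "S N k \<subseteq> E N k"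
      "outer_measure_of P (S N k) = emeasure P (E N k)" for N k
    by metis
  define V where "V N \<omega> = (INF k. indicator (E N k) \<omega> + r k)" for N \<omega>
  have bdd: "bdd_below (range (\<lambda>k. indicator (E N k) \<omega> + r k))" for N \<omega>
    by (rule bdd_belowI2[where m = 0]) (use r0 in \<open>auto simp: less_imp_le\<close>)
  have V_le: "V N \<omega> \<le> indicator (E N k) \<omega> + r k" for N \<omega> k
    unfolding V_def by (rule cINF_lower[OF bdd]) simp
  have V0: "0 \<le> V N \<omega>" for N \<omega>
    unfolding V_def by (rule cINF_greatest) (use r0 in \<open>auto simp: less_imp_le\<close>)
  have V_meas: "V N \<in> borel_measurable P" for N
    unfolding V_def using E(1) by measurable
  have "min (T N \<omega>) 1 \<le> V N \<omega>" if "\<omega> \<in> space P" for N \<omega>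
    unfolding V_def
  proof (rule cINF_greatest)
    fix k
    show "min (T N \<omega>) 1 \<le> indicator (E N k) \<omega> + r k"
    proof (cases "\<omega> \<in> E N k")
      case True
      then show ?thesis using r0[of k] by simp
    next
      case False
      then have "\<omega> \<notin> S N k" using E(2) by blast
      then show ?thesis using that False by (auto simp: S_def)
    qed
  qed simp
  moreover have "conv_in_prob P V"
    unfolding conv_in_prob_def
  proof (intro allI impI)
    fix \<epsilon> :: real assume "\<epsilon> > 0"
    \<comment> \<open>A single threshold below \<open>\<epsilon>\<close> suffices: off
      \<open>E N k\<close> the majorant is at most \<open>r k\<close>, so it exceeds
      \<open>\<epsilon>\<close> only on a hull whose measure tends to 0.\<close>
    then obtain k where k: "r k < \<epsilon>"
      unfolding r_def using nat_approx_posE by (metis Suc_eq_plus1 of_nat_Suc add.commute)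
    have "(\<lambda>N. emeasure P (E N k)) \<longlonglongrightarrow> 0"
      using assms(2) r0[of k] unfolding conv_outer_prob_def E(3)[symmetric] S_def by blast
    then have lim: "(\<lambda>N. measure P (E N k)) \<longlonglongrightarrow> 0"
      using P.emeasure_eq_measure tendsto_ennreal_iff[of _ sequentially 0] by simp
    have "measure P {\<omega>\<in>space P. \<bar>V N \<omega>\<bar> > \<epsilon>} \<le> measure P (E N k)" for N
    proof (rule P.finite_measure_mono[OF _ E(1)])
      show "{\<omega>\<in>space P. \<bar>V N \<omega>\<bar> > \<epsilon>} \<subseteq> E N k"
      proof
        fix \<omega> assume "\<omega> \<in> {\<omega>\<in>space P. \<bar>V N \<omega>\<bar> > \<epsilon>}"
        then have "r k < V N \<omega>" using V0[of N \<omega>] k by simp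
        then show "\<omega> \<in> E N k" using V_le[of N \<omega> k] by (cases "\<omega> \<in> E N k") auto
      qed
    qed
    then show "(\<lambda>N. measure P {\<omega>\<in>space P. \<bar>V N \<omega>\<bar> > \<epsilon>}) \<longlonglongrightarrow> 0"
      by (intro tendsto_sandwich[OF _ _ tendsto_const lim]) auto
  qed
  ultimately show ?thesis using V_meas by blast
qed

lemma conv_outer_almost_surely_majorant:
  assumes "conv_outer_almost_surely P T"
  shows "\<exists>V. (\<forall>N\<ge>1. V N \<in> borel_measurable P) \<and> conv_almost_surely P V \<and>
             (\<forall>N\<ge>1. \<forall>\<omega>\<in>space P. min (T N \<omega>) 1 \<le> V N \<omega>)"
proof -
  obtain U where U: "\<And>N. N \<ge> 1 \<Longrightarrow> measurable_cover P (\<lambda>\<omega>. \<bar>T N \<omega>\<bar>) (U N)"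
    and lim: "AE \<omega> in P. (\<lambda>N. U N \<omega>) \<longlonglongrightarrow> 0"
    using assms unfolding conv_outer_almost_surely_def by blast
  \<comment> \<open>The cover is itself a majorant, but extended real valued. Since
    \<open>real_of_ereal\<close> sends infinity to 0, it is cut at 1 before the conversion;
    otherwise the majorant could fail where the cover is infinite.\<close>
  define V where "V N \<omega> = real_of_ereal (min (U N \<omega>) 1)" for N \<omega>
  have "V N \<in> borel_measurable P" if "N \<ge> 1" for N
  proof -
    have [measurable]: "U N \<in> borel_measurable P"
      using U[OF that] by (simp add: measurable_cover_def)
    show ?thesis unfolding V_def by measurable
  qed
  moreover have "min (T N \<omega>) 1 \<le> V N \<omega>" if "N \<ge> 1" "\<omega> \<in> space P" for N \<omega>
  proof -
    have "ereal \<bar>T N \<omega>\<bar> \<le> U N \<omega>"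
      using U that by (auto simp: measurable_cover_def)
    then show ?thesis
      unfolding V_def by (cases "U N \<omega>") (auto simp: min_def one_ereal_def)
  qed
  moreover have "conv_almost_surely P V"
    unfolding conv_almost_surely_def using lim
  proof eventually_elim
    case (elim \<omega>)
    have "(\<lambda>N. min (U N \<omega>) 1) \<longlonglongrightarrow> min 0 1"
      by (intro tendsto_min elim tendsto_const)
    then have "(\<lambda>N. min (U N \<omega>) 1) \<longlonglongrightarrow> ereal 0"
      by (simp add: zero_ereal_def min_def)
    then have "(\<lambda>N. real_of_ereal (min (U N \<omega>) 1)) \<longlonglongrightarrow> 0"
      by (rule lim_real_of_ereal)
    then show ?case by (simp add: V_def)
  qed
  ultimately show ?thesis by blast
qed

lemma conv_in_prob_divide:
  assumes "conv_in_prob P V" "0 < (c::real)"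
  shows "conv_in_prob P (\<lambda>N \<omega>. V N \<omega> / c)"
  unfolding conv_in_prob_def
proof (intro allI impI)
  fix \<epsilon> :: real assume "\<epsilon> > 0"
  then have "0 < \<epsilon> * c" using assms by simp
  moreover have "\<bar>V N \<omega> / c\<bar> > \<epsilon> \<longleftrightarrow> \<bar>V N \<omega>\<bar> > \<epsilon> * c" for N \<omega>
    using assms(2) by (simp add: pos_less_divide_eq)
  ultimately show "(\<lambda>N. measure P {\<omega>\<in>space P. \<bar>V N \<omega> / c\<bar> > \<epsilon>}) \<longlonglongrightarrow> 0"
    using assms(1) unfolding conv_in_prob_def by simp
qed

lemma conv_almost_surely_divide:
  assumes "conv_almost_surely P V"
  shows "conv_almost_surely P (\<lambda>N \<omega>. V N \<omega> / (c::real))"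
  using assms unfolding conv_almost_surely_def
  by eventually_elim (rule tendsto_divide_zero)

section \<open>The sample space\<close>

lemma prob_space_sample_space:
  assumes "prob_space R" "prob_space Pd"
  shows "prob_space (sample_space R Pd)"
proof -
  interpret R: product_prob_space "\<lambda>_. R" "{1::nat..}"
    using assms(1) by (simp add: product_prob_space_def product_sigma_finite_def
        product_prob_space_axioms_def prob_space_imp_sigma_finite)
  show ?thesis
    unfolding sample_space_def
    by (intro prob_space_pair R.prob_space_axioms assms(2))
qed

text \<open>The conditions on a design are imposed at points of the product space, so this
  membership is what lets them be applied along \<open>Xvec\<close>.\<close>

lemma Xvec_in_space:
  assumes "sets R = sets (A \<Otimes>\<^sub>M B)" "\<omega> \<in> space (sample_space R Pd)"
  shows "Xvec N \<omega> \<in> space (\<Pi>\<^sub>M i\<in>{1..N}. B)"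
  using assms(2) sets_eq_imp_space_eq[OF assms(1)]
  by (auto simp: sample_space_def space_pair_measure space_PiM Xvec_def PiE_def Pi_def)

section \<open>Conditional asymptotic tightness from tightness of the limit\<close>

theorem theorem2:
  fixes A :: "'y measure" and B :: "'x measure"
    and R :: "('y \<times> 'x) measure" and Pd :: "'d measure" and D :: "'d \<Rightarrow> real"
    and e :: "nat \<Rightarrow> nat \<Rightarrow> nat \<Rightarrow> nat"
    and p :: "nat \<Rightarrow> (nat \<Rightarrow> nat) \<Rightarrow> (nat \<Rightarrow> 'x) \<Rightarrow> real"
    and F :: "'f set"
    and H :: "nat \<Rightarrow> (nat \<Rightarrow> 'y \<times> 'x) \<times> 'd \<Rightarrow> 'f \<Rightarrow> real"
    and G :: "nat \<Rightarrow> (nat \<Rightarrow> nat) \<Rightarrow> (nat \<Rightarrow> 'y) \<Rightarrow> (nat \<Rightarrow> 'x) \<Rightarrow> 'f \<Rightarrow> real"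
    and M :: "'b measure" and Hlim :: "'b \<Rightarrow> 'f \<Rightarrow> real"
  defines "P \<equiv> sample_space R Pd"
  assumes R: "prob_space R" "sets R = sets (A \<Otimes>\<^sub>M B)"
    and Pd: "prob_space Pd"
    and D: "D \<in> borel_measurable Pd" "\<And>w. w \<in> space Pd \<Longrightarrow> D w \<in> {0..1}"
      "distr Pd borel D = uniform_measure lborel {0..1}"
    and e: "\<And>N. N \<ge> 1 \<Longrightarrow> bij_betw (e N) {1..2 ^ N} (cube N)"
    and p: "sampling_design B p"
    and H_in: "\<And>N \<omega>. N \<ge> 1 \<Longrightarrow> \<omega> \<in> space P \<Longrightarrow> H N \<omega> \<in> mspace (linf F)"
    and H_dep: "\<And>N \<omega>. N \<ge> 1 \<Longrightarrow> \<omega> \<in> space P \<Longrightarrow>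
                  H N \<omega> = G N (Svec e p D N \<omega>) (Yvec N \<omega>) (Xvec N \<omega>)"
    and H_meas: "\<And>N f. N \<ge> 1 \<Longrightarrow> f \<in> F \<Longrightarrow> (\<lambda>\<omega>. H N \<omega> f) \<in> borel_measurable P"
    and M: "prob_space M"
    and Hlim: "Hlim \<in> M \<rightarrow>\<^sub>M linf_borel F" "tight_map F M Hlim"
  shows "(conv_outer_prob P (BL1_discrepancy F p G M Hlim) \<longrightarrow>
            cond_asymp_tight conv_in_prob P F p G) \<and>
         (conv_outer_almost_surely P (BL1_discrepancy F p G M Hlim) \<longrightarrow>
            cond_asymp_tight conv_almost_surely P F p G)"
proof -
  have PP: "prob_space P"
    unfolding P_def by (rule prob_space_sample_space[OF R(1) Pd])
  have pw: "0 \<le> p N s (Xvec N \<omega>)"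
    if "N \<ge> 1" "\<omega> \<in> space P" "s \<in> cube N" for N \<omega> s
    using p that Xvec_in_space[OF R(2), of \<omega> Pd N] by (auto simp: sampling_design_def P_def)
  have p1: "(\<Sum>s\<in>cube N. p N s (Xvec N \<omega>)) = 1" if "N \<ge> 1" "\<omega> \<in> space P" for N \<omega>
    using p that Xvec_in_space[OF R(2), of \<omega> Pd N] by (auto simp: sampling_design_def P_def)
  \<comment> \<open>\<open>H_in\<close> speaks of realised values only. Replacing the randomiser of
    \<open>\<omega>\<close> by one that draws \<open>s\<close> keeps \<open>Yvec\<close> and
    \<open>Xvec\<close>, so \<open>G N s\<close> at these data is a value of
    \<open>H N\<close>.\<close>
  have G_in: "G N s (Yvec N \<omega>) (Xvec N \<omega>) \<in> mspace (linf F)"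
    if N: "N \<ge> 1" and \<omega>: "\<omega> \<in> space P" and s: "s \<in> cube N" "0 < p N s (Xvec N \<omega>)" for N \<omega> s
  proof -
    obtain w where w: "w \<in> space Pd" "Svec e p D N (fst \<omega>, w) = s"
      using Svec_realised[of D Pd e N _ \<omega> p s, OF D(1,3) e[OF N] refl pw[OF N \<omega>] p1[OF N \<omega>] s] by auto
    have \<omega>': "(fst \<omega>, w) \<in> space P"
      using \<omega> w(1) by (auto simp: P_def sample_space_def space_pair_measure)
    have "Yvec N (fst \<omega>, w) = Yvec N \<omega>" "Xvec N (fst \<omega>, w) = Xvec N \<omega>"
      by (simp_all add: Yvec_def Xvec_def)
    then show ?thesis
      using H_in[OF N \<omega>'] H_dep[OF N \<omega>'] w(2) by simp
  qed
  \<comment> \<open>Both modes of convergence are handled at once, through a measurable majorant of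
    the truncated discrepancy whose positive rescalings converge to 0 in the given mode.\<close>
  have tight: "cond_asymp_tight conv P F p G"
    if V: "\<And>N. N \<ge> 1 \<Longrightarrow> V N \<in> borel_measurable P"
      and conv: "\<And>c::real. 0 < c \<Longrightarrow> conv P (\<lambda>N \<omega>. V N \<omega> / c)"
      and T: "\<And>N \<omega>. N \<ge> 1 \<Longrightarrow> \<omega> \<in> space P \<Longrightarrow> min (BL1_discrepancy F p G M Hlim N \<omega>) 1 \<le> V N \<omega>"
    for conv V
    unfolding cond_asymp_tight_def
  proof (intro allI impI)
    fix \<eta> :: real assume \<eta>: "\<eta> > 0"
    then obtain K0 where K0: "compactin (mtopology_of (linf F)) K0"
        "1 - \<eta> \<le> measure M {\<omega>\<in>space M. Hlim \<omega> \<in> K0}"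
      using Hlim(2) unfolding tight_map_def by blast
    obtain w0 where w0: "w0 \<in> space M"
      using prob_space.not_empty[OF M] by blast
    \<comment> \<open>For \<open>\<eta> \<ge> 1\<close> the compact set \<open>K0\<close> may be
      empty, and the tent would be a supremum over the empty set. One added value of the limit keeps
      compactness and cannot lower the probability. \<open>K\<close> is fixed before
      \<open>\<delta>\<close>.\<close>
    define K where "K = insert (Hlim w0) K0"
    have H0: "Hlim w0 \<in> mspace (linf F)"
      using measurable_space[OF Hlim(1) w0] by (simp add: space_linf_borel)
    have K: "compactin (mtopology_of (linf F)) K"
      unfolding K_def insert_is_Un[of _ K0] using H0 K0(1) by (intro compactin_Un) auto
    have KM: "{\<omega>\<in>space M. Hlim \<omega> \<in> K} \<in> sets M"
      using measurable_sets[OF Hlim(1) compactin_in_linf_borel[OF K]]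
      by (simp add: vimage_def Int_def conj_commute)
    have "measure M {\<omega>\<in>space M. Hlim \<omega> \<in> K0} \<le> measure M {\<omega>\<in>space M. Hlim \<omega> \<in> K}"
      by (rule finite_measure.finite_measure_mono[OF prob_space.finite_measure[OF M] _ KM])
        (auto simp: K_def)
    then have K\<eta>: "1 - \<eta> \<le> measure M {\<omega>\<in>space M. Hlim \<omega> \<in> K}"
      using K0(2) by linarith
    have "\<exists>A. (\<forall>N\<ge>1. A N \<in> borel_measurable P) \<and> conv P A \<and>
           (\<forall>N\<ge>1. \<forall>\<omega>\<in>space P.
              design_prob p N (\<lambda>s y x. G N s y x \<in> enlargement F K \<delta>) (Yvec N \<omega>) (Xvec N \<omega>)
                + A N \<omega> \<ge> 1 - \<eta>)" if \<delta>: "\<delta> > 0" for \<delta>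
    proof (intro exI conjI allI impI ballI)
      define c where "c = min \<delta> 1"
      have c: "0 < c" "c \<le> 1" "c \<le> \<delta>" using \<delta> by (auto simp: c_def)
      \<comment> \<open>This instantiates the remainder sequence as \<open>V N \<omega> / c\<close>;
        dividing by the height of the tent turns its expectation bound into a probability
        bound.\<close>
      show "conv P (\<lambda>N \<omega>. V N \<omega> / c)" by (rule conv[OF c(1)])
      fix N :: nat assume N: "N \<ge> 1"
      show "(\<lambda>\<omega>. V N \<omega> / c) \<in> borel_measurable P" using V[OF N] by measurable
      fix \<omega> assume \<omega>: "\<omega> \<in> space P"
      let ?q = "design_prob p N (\<lambda>s y x. G N s y x \<in> enlargement F K \<delta>) (Yvec N \<omega>) (Xvec N \<omega>)"
      have "K \<noteq> {}" by (simp add: K_def)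
      have 1: "c * (1 - \<eta> - ?q) \<le> BL1_discrepancy F p G M Hlim N \<omega>"
        unfolding BL1_discrepancy_def
        by (rule enlargement_prob_bound[where G = G and p = p, OF pw[OF N \<omega>] p1[OF N \<omega>] G_in[OF N \<omega>]
              M Hlim(1) K \<open>K \<noteq> {}\<close> K\<eta> c])
      \<comment> \<open>Truncation costs nothing: as \<open>?q \<ge> 0\<close> and
        \<open>\<eta> > 0\<close>, the left side of \<open>1\<close> is at most
        \<open>c \<le> 1\<close>, so it lies below the truncated discrepancy too.\<close>
      have "0 \<le> ?q"
        unfolding design_prob_def design_expectation_def
        by (intro sum_nonneg mult_nonneg_nonneg) (use pw[OF N \<omega>] in auto)
      then have "c * (1 - \<eta> - ?q) \<le> c * 1"
        using c \<eta> by (intro mult_left_mono) auto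
      then have "c * (1 - \<eta> - ?q) \<le> V N \<omega>"
        using 1 c T[OF N \<omega>] by linarith
      then have "1 - \<eta> - ?q \<le> V N \<omega> / c"
        using c(1) by (simp add: pos_le_divide_eq mult.commute)
      then show "1 - \<eta> \<le> ?q + V N \<omega> / c" by linarith
    qed
    with K show "\<exists>K. compactin (mtopology_of (linf F)) K \<and>
        (\<forall>\<delta>>0. \<exists>A. (\<forall>N\<ge>1. A N \<in> borel_measurable P) \<and> conv P A \<and>
           (\<forall>N\<ge>1. \<forall>\<omega>\<in>space P.
              design_prob p N (\<lambda>s y x. G N s y x \<in> enlargement F K \<delta>) (Yvec N \<omega>) (Xvec N \<omega>)
                + A N \<omega> \<ge> 1 - \<eta>))" by blast
  qed
  show ?thesis
  proof (intro conjI impI)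
    assume "conv_outer_prob P (BL1_discrepancy F p G M Hlim)"
    from conv_outer_prob_majorant[OF PP this] show "cond_asymp_tight conv_in_prob P F p G"
      using tight conv_in_prob_divide by metis
  next
    assume "conv_outer_almost_surely P (BL1_discrepancy F p G M Hlim)"
    from conv_outer_almost_surely_majorant[OF this] show "cond_asymp_tight conv_almost_surely P F p G"
      using tight conv_almost_surely_divide by metis
  qed
qed

end
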